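(* For some universal constant $C>0$, there exist monotone paths of length $>\frac{C}{n^2}\sqrt[3]{n!}$ on the shortest path polytope on the complete graph $K_n$.
   Context: The shortest path polytope on $n$ nodes is the convex hull of the 0/1 incidence vectors of directed paths without cycles (all nodes distinct) from node $1$ to node $n$ in the complete directed graph on $\{1,\dots,n\}$; coordinates are $x_{i,j}$ for $1\le i\le n-1$, $2\le j\le n$, $i\ne j$, where $x_{i,j}$ corresponds to the arc from $i$ to $j$. For a polytope $Q$, a linear objective $c$ (to be minimized) is nondegenerate if no two vertices have the same objective value; each edge of $Q$ is oriented toward its endpoint of smaller value. A monotone path (for $c$) is a directed path in this oriented graph from some vertex to the optimal vertex, for some nondegenerate $c$; its length is its number of edges. *)

theory Defs
  imports "HOL-Analysis.Analysis" "HOL-Analysis.Finite_Function_Topology"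
begin

text \<open>
  Since the set of coordinates varies with \<open>n\<close> (and \<open>n\<close> is quantified inside the
  theorem), the ambient space is the real vector space of finitely supported functions on
  pairs of nodes; all coordinates other than those of the arcs in use vanish.
\<close>

type_synonym arc_vector = "(nat \<times> nat) \<Rightarrow>\<^sub>0 real"

definition source_target_path :: "nat \<Rightarrow> nat list \<Rightarrow> bool" where
  "source_target_path n p \<longleftrightarrow>
     p \<noteq> [] \<and> hd p = 1 \<and> last p = n \<and> distinct p \<and> set p \<subseteq> {1..n}"

definition path_arcs :: "nat list \<Rightarrow> (nat \<times> nat) set" where
  "path_arcs p = set (zip p (tl p))"

definition incidence_vector :: "(nat \<times> nat) set \<Rightarrow> arc_vector" where
  "incidence_vector A = (\<Sum>a\<in>A. Poly_Mapping.single a 1)"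

text \<open>
  The coordinates that can be nonzero are exactly the pairs \<open>(i, j)\<close> with
  \<open>1 \<le> i \<le> n - 1\<close>, \<open>2 \<le> j \<le> n\<close> and \<open>i \<noteq> j\<close>: a path with distinct nodes
  never enters its start \<open>1\<close> and never leaves its end \<open>n\<close>.
\<close>

definition shortest_path_polytope :: "nat \<Rightarrow> arc_vector set" where
  "shortest_path_polytope n =
     convex hull {incidence_vector (path_arcs p) | p. source_target_path n p}"

text \<open>The notions below are for an arbitrary polytope; objectives are minimized.\<close>

definition nondegenerate_objective :: "'a::real_vector set \<Rightarrow> ('a \<Rightarrow> real) \<Rightarrow> bool" where
  "nondegenerate_objective Q c \<longleftrightarrow> linear c \<and> inj_on c {v. v extreme_point_of Q}"

text \<open>
  The library's \<open>edge_of\<close> is only available in Euclidean spaces. A one-dimensional face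
  of a polytope is the segment between its two distinct endpoints, which are vertices.
\<close>

definition polytope_edge :: "'a::real_vector set \<Rightarrow> 'a \<Rightarrow> 'a \<Rightarrow> bool" where
  "polytope_edge Q u v \<longleftrightarrow>
     u extreme_point_of Q \<and> v extreme_point_of Q \<and> u \<noteq> v \<and> closed_segment u v face_of Q"

definition oriented_edge :: "'a::real_vector set \<Rightarrow> ('a \<Rightarrow> real) \<Rightarrow> 'a \<Rightarrow> 'a \<Rightarrow> bool" where
  "oriented_edge Q c u v \<longleftrightarrow> polytope_edge Q u v \<and> c v < c u"

definition optimal_vertex :: "'a::real_vector set \<Rightarrow> ('a \<Rightarrow> real) \<Rightarrow> 'a \<Rightarrow> bool" where
  "optimal_vertex Q c v \<longleftrightarrow> v extreme_point_of Q \<and> (\<forall>x\<in>Q. c v \<le> c x)"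

text \<open>
  A path is given by the list of vertices it visits, so it has one edge fewer than the list
  has entries. Vertices cannot repeat, because the objective strictly decreases.
\<close>

definition monotone_path_for ::
    "'a::real_vector set \<Rightarrow> ('a \<Rightarrow> real) \<Rightarrow> 'a list \<Rightarrow> bool" where
  "monotone_path_for Q c vs \<longleftrightarrow>
     vs \<noteq> [] \<and> set vs \<subseteq> {v. v extreme_point_of Q} \<and>
     successively (oriented_edge Q c) vs \<and> optimal_vertex Q c (last vs)"

definition monotone_path :: "'a::real_vector set \<Rightarrow> 'a list \<Rightarrow> bool" where
  "monotone_path Q vs \<longleftrightarrow>
     (\<exists>c. nondegenerate_objective Q c \<and> monotone_path_for Q c vs)"

definition path_length :: "'a list \<Rightarrow> nat" where
  "path_length vs = length vs - 1"

end

theory Submission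
  imports Defs "HOL-Library.Nat_Bijection"
begin

text \<open>
  Every arc gets the cost \<open>2 ^ r\<close> with distinct ranks \<open>r\<close>, so two paths are compared by the
  largest arc in which they differ. Two paths that fork at \<open>v\<close>, run through disjoint sets of
  nodes and meet again at \<open>w\<close> are adjacent, since no third path lives on their arcs. With
  \<open>e = n - 1\<close>, a chain from \<open>s \<rightarrow> n\<close> to \<open>s \<rightarrow> e \<rightarrow> n\<close> on free nodes \<open>U\<close> is built recursively. For each
  \<open>x \<in> U\<close> in increasing order it moves to \<open>s \<rightarrow> x \<rightarrow> s + 1 \<rightarrow> n\<close>, runs the chain of \<open>s + 1\<close> on
  \<open>U - {x}\<close>, which ends in \<open>s \<rightarrow> x \<rightarrow> s + 1 \<rightarrow> e \<rightarrow> n\<close>, and escapes to \<open>s \<rightarrow> x \<rightarrow> e \<rightarrow> n\<close>. That path shares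
  no inner node after \<open>s\<close> with the next \<open>s \<rightarrow> y \<rightarrow> s + 1 \<rightarrow> n\<close>, so the recursion continues there. This
  uses two nodes per level and gives about \<open>(n / 2)!\<close> steps.
\<close>

section \<open>Faces of a finite convex hull exposed by a linear functional\<close>

lemma linear_ge_on_convex_hull:
  fixes f :: "'a::real_vector \<Rightarrow> real"
  assumes "linear f" and "\<And>x. x \<in> S \<Longrightarrow> m \<le> f x" and "x \<in> convex hull S"
  shows "m \<le> f x"
proof -
  have "convex {x. m \<le> f x}"
    using convex_linear_vimage[OF \<open>linear f\<close>, of "{m..}"] by (simp add: vimage_def)
  then have "convex hull S \<subseteq> {x. m \<le> f x}"
    using assms(2) by (intro hull_minimal) auto
  then show ?thesis using assms(3) by auto
qed

text \<open>A convex combination attaining the lower bound \<open>m\<close> averages the nonnegative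
  gaps \<open>f y - m\<close> to zero, so it puts weight only on the points of \<open>S\<close> with
  value \<open>m\<close>. The same argument on a segment forces both endpoints down to
  \<open>m\<close>.\<close>

lemma convex_hull_minimizers_face_of:
  fixes f :: "'a::real_vector \<Rightarrow> real"
  assumes "finite S" "linear f" and ge: "\<And>x. x \<in> S \<Longrightarrow> m \<le> f x"
  shows "convex hull {x \<in> S. f x = m} face_of convex hull S"
proof -
  interpret f: linear f by fact
  note hull_ge = linear_ge_on_convex_hull[OF assms(2) ge]
  have min_eq: "x \<in> convex hull {x \<in> S. f x = m}" if x: "x \<in> convex hull S" "f x = m" for x
  proof -
    obtain u where u: "\<forall>y\<in>S. 0 \<le> u y" "sum u S = 1" "(\<Sum>y\<in>S. u y *\<^sub>R y) = x"
      using x(1) unfolding convex_hull_finite[OF assms(1)] by auto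
    have "(\<Sum>y\<in>S. u y * (f y - m)) = f x - m"
      using u(2) by (simp add: u(3)[symmetric] f.sum f.scale right_diff_distrib sum_subtractf
          flip: sum_distrib_right)
    then have "(\<Sum>y\<in>S. u y * (f y - m)) = 0" using x(2) by simp
    then have "\<forall>y\<in>S. u y * (f y - m) = 0"
      using u(1) ge assms(1) by (simp add: sum_nonneg_eq_0_iff)
    then have zero: "\<forall>y\<in>S - {y \<in> S. f y = m}. u y = 0"
      by auto
    have "sum u {y \<in> S. f y = m} = 1"
      using u(2) zero by (subst sum.mono_neutral_left[OF assms(1)]) auto
    moreover have "(\<Sum>y\<in>{y \<in> S. f y = m}. u y *\<^sub>R y) = x"
      unfolding u(3)[symmetric] using zero by (intro sum.mono_neutral_left assms(1)) auto
    ultimately show ?thesis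
      using u(1) assms(1) by (subst convex_hull_finite) auto
  qed
  have eq_m: "f x = m" if "x \<in> convex hull {x \<in> S. f x = m}" for x
  proof -
    have "convex {x. f x = m}"
      using convex_linear_vimage[OF \<open>linear f\<close>, of "{m}"] by (simp add: vimage_def)
    then have "convex hull {x \<in> S. f x = m} \<subseteq> {x. f x = m}"
      by (intro hull_minimal) auto
    then show ?thesis using that by auto
  qed
  show ?thesis
    unfolding face_of_def
  proof (intro conjI ballI impI)
    show "convex hull {x \<in> S. f x = m} \<subseteq> convex hull S"
      by (intro hull_mono) auto
    show "convex (convex hull {x \<in> S. f x = m})" by simp
    fix a b x
    assume ab: "a \<in> convex hull S" "b \<in> convex hull S"
      and x: "x \<in> convex hull {x \<in> S. f x = m}" "x \<in> open_segment a b"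
    obtain t where t: "0 < t" "t < 1" "x = (1 - t) *\<^sub>R a + t *\<^sub>R b"
      using x(2) by (auto simp: in_segment)
    have "f x = (1 - t) * f a + t * f b"
      unfolding t(3) by (simp add: f.add f.scale)
    then have "(1 - t) * (f a - m) + t * (f b - m) = 0"
      using eq_m[OF x(1)] by (simp add: algebra_simps)
    moreover have "0 \<le> (1 - t) * (f a - m)" "0 \<le> t * (f b - m)"
      using t hull_ge ab by auto
    ultimately have "(1 - t) * (f a - m) = 0" "t * (f b - m) = 0"
      by linarith+
    with t have "f a = m" "f b = m" by auto
    with ab show "a \<in> convex hull {x \<in> S. f x = m}" "b \<in> convex hull {x \<in> S. f x = m}"
      using min_eq by blast+
  qed
qed

section \<open>Arcs of a path, and paths confined to the arcs of a fork\<close>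

lemma path_arcs_Nil [simp]: "path_arcs [] = {}"
  and path_arcs_single [simp]: "path_arcs [x] = {}"
  and path_arcs_Cons_Cons [simp]: "path_arcs (x # y # p) = insert (x, y) (path_arcs (y # p))"
  by (auto simp: path_arcs_def)

lemma finite_path_arcs [simp]: "finite (path_arcs p)"
  by (simp add: path_arcs_def)

lemma path_arcs_Cons: "p \<noteq> [] \<Longrightarrow> path_arcs (x # p) = insert (x, hd p) (path_arcs p)"
  by (cases p) auto

lemma path_arcs_split: "path_arcs (p @ v # q) = path_arcs (p @ [v]) \<union> path_arcs (v # q)"
proof (induction p)
  case (Cons x p)
  then show ?case by (cases p) auto
qed auto

lemma path_arcs_in_set: "(x, y) \<in> path_arcs p \<Longrightarrow> x \<in> set p \<and> y \<in> set p"
  unfolding path_arcs_def by (cases p) (auto dest: set_zip_leftD set_zip_rightD)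

lemma path_arcs_source: "(x, y) \<in> path_arcs (p @ [v]) \<Longrightarrow> x \<in> set p"
proof (induction p)
  case (Cons z p)
  then show ?case by (cases p) auto
qed auto

lemma path_arcs_unique:
  assumes "distinct p" "(x, y) \<in> path_arcs p" "(x, z) \<in> path_arcs p"
  shows "y = z"
  using assms
proof (induction p)
  case (Cons a p)
  then show ?case by (cases p) (auto dest: path_arcs_in_set)
qed auto

text \<open>Each node of \<open>l\<close> has a single successor in \<open>l\<close>, so
  \<open>r\<close> is forced along \<open>l\<close> from the common start, and the common last node
  makes both stop together. Only arcs of \<open>r\<close> leaving nodes of \<open>l\<close> are
  constrained, so one branch of a fork can be treated before it is known that \<open>r\<close>
  avoids the other.\<close>

lemma path_eqI:
  assumes "distinct r" "distinct l" "r \<noteq> []" "l \<noteq> []" "hd r = hd l" "last r = last l"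
    and "\<And>x y. \<lbrakk>(x, y) \<in> path_arcs r; x \<in> set l\<rbrakk> \<Longrightarrow> (x, y) \<in> path_arcs l"
  shows "r = l"
  using assms
proof (induction l arbitrary: r)
  case (Cons x l)
  from Cons.prems obtain r' where r: "r = x # r'"
    by (cases r) auto
  show ?case
  proof (cases "l = []")
    case True
    then show ?thesis using Cons.prems r by (cases r') (auto split: if_splits)
  next
    case False
    then have "r' \<noteq> []" using Cons.prems r by (auto split: if_splits)
    then have "(x, hd r') \<in> path_arcs r" using r by (simp add: path_arcs_Cons)
    then have "(x, hd r') \<in> path_arcs (x # l)" using Cons.prems by simp
    moreover have "(x, hd l) \<in> path_arcs (x # l)" using False by (simp add: path_arcs_Cons)
    ultimately have "hd r' = hd l" using Cons.prems path_arcs_unique by metis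
    then have "r' = l"
      using Cons.prems r False \<open>r' \<noteq> []\<close>
      by (intro Cons.IH) (auto simp: path_arcs_Cons)
    then show ?thesis using r by simp
  qed
qed simp

text \<open>The only choice is at \<open>v\<close>: before it both paths have the same outgoing
  arcs, and after it the disjointness of \<open>a\<close> and \<open>b\<close> leaves each node of
  the chosen branch only its own outgoing arc.\<close>

lemma path_in_fork:
  assumes "distinct (p @ v # a @ w # q)" "distinct (p @ v # b @ w # q)" "set a \<inter> set b = {}"
    and "distinct r" "r \<noteq> []" "hd r = hd (p @ [v])" "last r = last (w # q)"
    and "\<And>e. \<lbrakk>e \<in> path_arcs r; fst e \<in> set (p @ v # a @ w # q) \<union> set (p @ v # b @ w # q)\<rbrakk>
      \<Longrightarrow> e \<in> path_arcs (p @ v # a @ w # q) \<union> path_arcs (p @ v # b @ w # q)"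
  shows "r = p @ v # a @ w # q \<or> r = p @ v # b @ w # q"
  using assms
proof (induction p arbitrary: r)
  case Nil
  have branch: "r' = c @ w # q"
    if r: "r = v # r'" "r' \<noteq> []" "hd r' = hd (c @ w # q)" and cd: "set c \<inter> set d = {}"
      and dist: "distinct (v # c @ w # q)" "distinct (v # d @ w # q)"
      and arcs: "\<And>e. \<lbrakk>e \<in> path_arcs r; fst e \<in> set (v # c @ w # q) \<union> set (v # d @ w # q)\<rbrakk>
        \<Longrightarrow> e \<in> path_arcs (v # c @ w # q) \<union> path_arcs (v # d @ w # q)" for c d r'
  proof (rule path_eqI)
    fix x y
    assume xy: "(x, y) \<in> path_arcs r'" "x \<in> set (c @ w # q)"
    then have "(x, y) \<in> path_arcs (v # c @ w # q) \<union> path_arcs (v # d @ w # q)"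
      using r arcs[of "(x, y)"] by (auto simp: path_arcs_Cons)
    moreover have "x \<noteq> v" using xy dist by auto
    \<comment> \<open>An arc of the other branch before \<open>w\<close> starts in \<open>d\<close>,
      which is disjoint from \<open>c\<close>.\<close>
    moreover have "(x, y) \<in> path_arcs (w # q)" if "(x, y) \<in> path_arcs (d @ w # q)"
      using that xy(2) cd dist path_arcs_source[of x y d w]
      by (subst (asm) path_arcs_split) auto
    ultimately show "(x, y) \<in> path_arcs (c @ w # q)"
      by (auto simp: path_arcs_Cons path_arcs_split[of c w q])
  qed (use Nil r dist in \<open>auto split: if_splits\<close>)
  obtain r' where r: "r = v # r'" using Nil by (cases r) auto
  have "r' \<noteq> []" using Nil r by (auto split: if_splits)
  then have "(v, hd r') \<in> path_arcs (v # a @ w # q) \<union> path_arcs (v # b @ w # q)"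
    using Nil.prems(8)[of "(v, hd r')"] r by (auto simp: path_arcs_Cons)
  then have "hd r' = hd (a @ w # q) \<or> hd r' = hd (b @ w # q)"
    using Nil.prems(1,2) by (auto simp: path_arcs_Cons dest: path_arcs_in_set)
  then show ?case
    using branch[of r' a b] branch[of r' b a] r \<open>r' \<noteq> []\<close> Nil.prems by auto
next
  case (Cons x p)
  obtain r' where r: "r = x # r'" using Cons by (cases r) auto
  have "r' \<noteq> []" using Cons r by (auto split: if_splits)
  let ?P = "p @ v # a @ w # q" and ?Q = "p @ v # b @ w # q"
  have hd_eq: "hd ?P = hd (p @ [v])" "hd ?Q = hd (p @ [v])" by (cases p; simp)+
  have "(x, hd r') \<in> path_arcs (x # ?P) \<union> path_arcs (x # ?Q)"
    using Cons.prems(8)[of "(x, hd r')"] r \<open>r' \<noteq> []\<close> by (auto simp: path_arcs_Cons)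
  then have "hd r' = hd (p @ [v])"
    using Cons.prems(1,2) hd_eq by (auto simp: path_arcs_Cons dest: path_arcs_in_set)
  moreover have "e \<in> path_arcs ?P \<union> path_arcs ?Q"
    if "e \<in> path_arcs r'" "fst e \<in> set ?P \<union> set ?Q" for e
  proof -
    have "e \<in> path_arcs (x # ?P) \<union> path_arcs (x # ?Q)"
      using Cons.prems(8)[of e] that r \<open>r' \<noteq> []\<close> by (auto simp: path_arcs_Cons)
    moreover have "fst e \<noteq> x" using that(2) Cons.prems(1,2) by auto
    ultimately show ?thesis by (auto simp: path_arcs_Cons)
  qed
  ultimately have "r' = ?P \<or> r' = ?Q"
    using Cons.prems r \<open>r' \<noteq> []\<close> by (intro Cons.IH) (auto split: if_splits)
  then show ?case using r by auto
qed

section \<open>Vertices and edges of the shortest path polytope\<close>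

definition arc_functional :: "(nat \<times> nat) set \<Rightarrow> (nat \<times> nat \<Rightarrow> real) \<Rightarrow> arc_vector \<Rightarrow> real" where
  "arc_functional A w x = (\<Sum>e\<in>A. w e * Poly_Mapping.lookup x e)"

lemma lookup_scaleR: "Poly_Mapping.lookup (r *\<^sub>R x) e = r *\<^sub>R Poly_Mapping.lookup x e"
proof -
  have "finite {e. r *\<^sub>R Poly_Mapping.lookup x e \<noteq> 0}"
    by (rule finite_subset[OF _ finite_lookup[of x]]) auto
  then show ?thesis unfolding scaleR_poly_mapping_def by simp
qed

lemma linear_arc_functional: "linear (arc_functional A w)"
  by (rule linearI) (simp_all add: arc_functional_def lookup_add lookup_scaleR algebra_simps
      sum.distrib sum_distrib_left)

lemma lookup_incidence_vector:
  "finite B \<Longrightarrow> Poly_Mapping.lookup (incidence_vector B) e = (if e \<in> B then 1 else 0)"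
  by (simp add: incidence_vector_def lookup_sum lookup_single when_def)

lemma arc_functional_incidence_vector:
  "\<lbrakk>finite A; B \<subseteq> A\<rbrakk> \<Longrightarrow> arc_functional A w (incidence_vector B) = sum w B"
  by (auto simp: arc_functional_def lookup_incidence_vector finite_subset if_distrib sum.If_cases
      Int_absorb1 cong: if_cong)

abbreviation path_vector :: "nat list \<Rightarrow> arc_vector" where
  "path_vector p \<equiv> incidence_vector (path_arcs p)"

abbreviation grid_arcs :: "nat \<Rightarrow> (nat \<times> nat) set" where
  "grid_arcs n \<equiv> {1..n} \<times> {1..n}"

lemma path_arcs_grid: "source_target_path n p \<Longrightarrow> path_arcs p \<subseteq> grid_arcs n"
  unfolding source_target_path_def by (force dest: path_arcs_in_set)

lemma shortest_path_polytope_eq: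
  "shortest_path_polytope n = convex hull (path_vector ` Collect (source_target_path n))"
  unfolding shortest_path_polytope_def by (rule arg_cong[where f="\<lambda>S. convex hull S"]) auto

lemma finite_source_target_paths: "finite (Collect (source_target_path n))"
  by (rule finite_subset[OF _ finite_subset_distinct[of "{1..n}"]])
    (auto simp: source_target_path_def subset_eq)

text \<open>The functional counting the arcs outside \<open>F\<close> is nonnegative on all path
  vectors and vanishes exactly on those from \<open>T\<close>.\<close>

lemma face_of_shortest_path_polytope:
  assumes "\<And>p. source_target_path n p \<Longrightarrow> path_arcs p \<subseteq> F \<longleftrightarrow> p \<in> T"
    and T: "T \<subseteq> Collect (source_target_path n)"
  shows "convex hull (path_vector ` T) face_of shortest_path_polytope n"
proof -
  define f where "f = arc_functional (grid_arcs n) (\<lambda>e. if e \<in> F then 0 else 1)"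
  let ?S = "path_vector ` Collect (source_target_path n)"
  have f: "f (path_vector p) = card (path_arcs p - F)" if "source_target_path n p" for p
    using path_arcs_grid[OF that]
    by (simp add: f_def arc_functional_incidence_vector sum.If_cases Diff_eq)
  have "{x \<in> ?S. f x = 0} = path_vector ` T"
    using f assms by (auto simp: subset_eq)
  moreover have "convex hull {x \<in> ?S. f x = 0} face_of convex hull ?S"
    using f by (intro convex_hull_minimizers_face_of)
      (auto simp: f_def linear_arc_functional finite_source_target_paths)
  ultimately show ?thesis by (simp add: shortest_path_polytope_eq)
qed

lemma fork_face_of:
  assumes P: "source_target_path n (p @ v # a @ w # q)" (is "source_target_path n ?P")
    and Q: "source_target_path n (p @ v # b @ w # q)" (is "source_target_path n ?Q")
    and "set a \<inter> set b = {}"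
  shows "closed_segment (path_vector ?P) (path_vector ?Q) face_of shortest_path_polytope n"
proof -
  have "r \<in> {?P, ?Q}"
    if r: "source_target_path n r" "path_arcs r \<subseteq> path_arcs ?P \<union> path_arcs ?Q" for r
  proof -
    have "hd (p @ [v]) = 1" using P by (cases p) (auto simp: source_target_path_def)
    then show ?thesis
      using path_in_fork[of p v a w q b r] assms r
      by (auto simp: source_target_path_def)
  qed
  then have "convex hull (path_vector ` {?P, ?Q}) face_of shortest_path_polytope n"
    using P Q by (intro face_of_shortest_path_polytope[of n "path_arcs ?P \<union> path_arcs ?Q"]) auto
  then show ?thesis by (simp add: segment_convex_hull)
qed

lemma path_vector_extreme_point:
  assumes "source_target_path n p"
  shows "path_vector p extreme_point_of shortest_path_polytope n"
proof -
  have "r = p" if "source_target_path n r" "path_arcs r \<subseteq> path_arcs p" for r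
    using that assms by (intro path_eqI) (auto simp: source_target_path_def)
  then have "convex hull (path_vector ` {p}) face_of shortest_path_polytope n"
    using assms by (intro face_of_shortest_path_polytope[of n "path_arcs p"]) auto
  then show ?thesis by (simp add: face_of_singleton)
qed

lemma path_arcs_inj:
  "\<lbrakk>source_target_path n p; source_target_path n q; path_arcs p = path_arcs q\<rbrakk> \<Longrightarrow> p = q"
  by (intro path_eqI) (auto simp: source_target_path_def)

section \<open>The objective function\<close>

text \<open>
  Arcs leaving smaller nodes dominate. Among arcs with a common source the one into \<open>n\<close> ranks
  highest and the others rank lower as their target label grows, so \<open>n - 1\<close> is the cheapest exit.
\<close>

definition arc_rank :: "nat \<Rightarrow> nat \<times> nat \<Rightarrow> nat" where
  "arc_rank n e = (n - fst e) * (n + 1) + (if snd e = n then n else n - snd e)"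

definition rank_cost :: "nat \<Rightarrow> arc_vector \<Rightarrow> real" where
  "rank_cost n = arc_functional (grid_arcs n) (\<lambda>e. 2 ^ arc_rank n e)"

text \<open>The second summand of \<open>arc_rank\<close> is at most \<open>n\<close>, so the factor
  \<open>n + 1\<close> lets the source decide first.\<close>

lemma arc_rank_less:
  assumes "i < j" "j \<le> n"
  shows "arc_rank n (j, l) < arc_rank n (i, m)"
proof -
  have "arc_rank n (j, l) \<le> (n - j) * (n + 1) + n"
    by (simp add: arc_rank_def)
  also have "\<dots> < (n - j + 1) * (n + 1)" by simp
  also have "\<dots> \<le> (n - i) * (n + 1)"
    using assms by (intro mult_right_mono) auto
  also have "\<dots> \<le> arc_rank n (i, m)" by (simp add: arc_rank_def)
  finally show ?thesis .
qed

lemma inj_on_arc_rank: "inj_on (arc_rank n) (grid_arcs n)"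
proof (rule inj_onI)
  fix e f assume ef: "e \<in> grid_arcs n" "f \<in> grid_arcs n" "arc_rank n e = arc_rank n f"
  then have "fst e = fst f"
    using arc_rank_less[of "fst e" "fst f" n "snd f" "snd e"]
      arc_rank_less[of "fst f" "fst e" n "snd e" "snd f"]
    by (cases "fst e" "fst f" rule: linorder_cases) auto
  \<comment> \<open>With equal sources, targets \<open>j\<close> in \<open>{1..<n}\<close>
    contribute \<open>n - j < n\<close>, so none collides with the value \<open>n\<close> reserved
    for target \<open>n\<close>.\<close>
  with ef show "e = f" by (auto simp: arc_rank_def prod_eq_iff split: if_splits)
qed

text \<open>Since ranks are distinct, the cost is the binary number whose bits are the ranks of the
  arcs used. Nondegeneracy thus becomes injectivity of \<open>set_encode\<close>.\<close>

lemma rank_cost_path: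
  assumes "source_target_path n p"
  shows "rank_cost n (path_vector p) = real (set_encode (arc_rank n ` path_arcs p))"
proof -
  have "inj_on (arc_rank n) (path_arcs p)"
    using path_arcs_grid[OF assms] inj_on_arc_rank inj_on_subset by blast
  then show ?thesis
    using path_arcs_grid[OF assms]
    by (simp add: rank_cost_def arc_functional_incidence_vector set_encode_def sum.reindex)
qed

text \<open>All bits below \<open>m\<close> together sum to less than \<open>2 ^ m\<close>; the
  common bits cancel.\<close>

lemma set_encode_less:
  assumes "finite A" "finite B" "m \<in> A - B" "\<And>x. x \<in> B - A \<Longrightarrow> x < m"
  shows "set_encode B < set_encode A"
proof -
  have "(\<Sum>x\<in>B - A. 2 ^ x) \<le> (\<Sum>x<m. 2 ^ x :: nat)"
    using assms by (intro sum_mono2) auto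
  also have "\<dots> < 2 ^ m" by (induction m) auto
  also have "\<dots> \<le> (\<Sum>x\<in>A - B. 2 ^ x)"
    using assms member_le_sum[of m "A - B" "\<lambda>x. 2 ^ x :: nat"] by auto
  finally have "(\<Sum>x\<in>B - A. 2 ^ x) < (\<Sum>x\<in>A - B. 2 ^ x :: nat)" .
  then show ?thesis
    unfolding set_encode_def
    using sum.Int_Diff[OF assms(1), of "\<lambda>x. 2 ^ x :: nat" B]
      sum.Int_Diff[OF assms(2), of "\<lambda>x. 2 ^ x :: nat" A]
    by (simp add: Int_commute)
qed

lemma rank_cost_less:
  assumes "source_target_path n p" "source_target_path n q"
    and "e \<in> path_arcs p - path_arcs q"
    and "\<And>f. f \<in> path_arcs q - path_arcs p \<Longrightarrow> arc_rank n f < arc_rank n e"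
  shows "rank_cost n (path_vector q) < rank_cost n (path_vector p)"
proof -
  have "arc_rank n e \<notin> arc_rank n ` path_arcs q"
    using assms(1-3) path_arcs_grid[of n p] path_arcs_grid[of n q] inj_onD[OF inj_on_arc_rank[of n]]
    by blast
  then have "set_encode (arc_rank n ` path_arcs q) < set_encode (arc_rank n ` path_arcs p)"
    using assms(3,4) by (intro set_encode_less[of _ _ "arc_rank n e"]) auto
  then show ?thesis using assms(1,2) by (simp add: rank_cost_path)
qed

lemma nondegenerate_rank_cost:
  "nondegenerate_objective (shortest_path_polytope n) (rank_cost n)"
  unfolding nondegenerate_objective_def
proof
  show "linear (rank_cost n)"
    unfolding rank_cost_def by (rule linear_arc_functional)
  have "p = q" if "source_target_path n p" "source_target_path n q"
    "rank_cost n (path_vector p) = rank_cost n (path_vector q)" for p q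
  proof -
    have "arc_rank n ` path_arcs p = arc_rank n ` path_arcs q"
      using that by (simp add: rank_cost_path set_encode_eq)
    then have "path_arcs p = path_arcs q"
      using that path_arcs_grid inj_on_image_eq_iff[OF inj_on_arc_rank] by metis
    then show ?thesis using that path_arcs_inj by blast
  qed
  then have "inj_on (rank_cost n) (path_vector ` Collect (source_target_path n))"
    by (auto simp: inj_on_def)
  then show "inj_on (rank_cost n) {v. v extreme_point_of shortest_path_polytope n}"
    by (rule inj_on_subset)
      (auto simp: shortest_path_polytope_eq dest: extreme_point_of_convex_hull)
qed

section \<open>Improving edges and the recursive chain\<close>

text \<open>The relation lives on node lists, where forks are visible, so that chains can be
  composed as relation powers; validity of both paths is carried along.\<close>

definition path_step :: "nat \<Rightarrow> nat list \<Rightarrow> nat list \<Rightarrow> bool" where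
  "path_step n p q \<longleftrightarrow> source_target_path n p \<and> source_target_path n q \<and>
     oriented_edge (shortest_path_polytope n) (rank_cost n) (path_vector p) (path_vector q)"

text \<open>The two paths differ only between \<open>v\<close> and \<open>w\<close>, and the first
  arc of the old branch outranks every arc of the new one. Writing its target as
  \<open>hd (a @ [w])\<close> covers the direct arc, where \<open>a\<close> is empty.\<close>

lemma fork_path_step:
  assumes P: "source_target_path n (p @ v # a @ w # q)" (is "source_target_path n ?P")
    and Q: "source_target_path n (p @ v # b @ w # q)" (is "source_target_path n ?Q")
    and disj: "set a \<inter> set b = {}"
    and less: "\<forall>f \<in> path_arcs (v # b @ [w]). arc_rank n f < arc_rank n (v, hd (a @ [w]))"
  shows "path_step n ?P ?Q"
proof -
  let ?e = "(v, hd (a @ [w]))"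
  have split: "path_arcs (p @ v # c @ w # q) =
      path_arcs (p @ [v]) \<union> path_arcs (v # c @ [w]) \<union> path_arcs (w # q)" for c
    using path_arcs_split[of p v "c @ w # q"] path_arcs_split[of "v # c" w q] by auto
  have "?e \<in> path_arcs (v # a @ [w])" by (simp add: path_arcs_Cons)
  moreover have "?e \<notin> path_arcs (v # b @ [w])" using less by blast
  moreover have "?e \<notin> path_arcs (p @ [v])" "?e \<notin> path_arcs (w # q)"
    using P by (auto simp: source_target_path_def dest: path_arcs_source path_arcs_in_set)
  ultimately have less_cost: "rank_cost n (path_vector ?Q) < rank_cost n (path_vector ?P)"
    using less by (intro rank_cost_less[OF P Q, of ?e]) (auto simp: split)
  then show ?thesis
    unfolding path_step_def oriented_edge_def polytope_edge_def
    using P Q path_vector_extreme_point fork_face_of[OF P Q disj] by auto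
qed

lemma arc_rank_same_source:
  "\<lbrakk>1 \<le> j; j < n; k = n \<or> k < j\<rbrakk> \<Longrightarrow> arc_rank n (i, j) < arc_rank n (i, k)"
  by (auto simp: arc_rank_def)

text \<open>The prefix \<open>p\<close> collects the nodes fixed by outer levels,
  \<open>s, ..., s + d\<close> are the level nodes still to come, and \<open>U\<close> holds the
  free nodes. Every free node exceeds every level node and is below \<open>n - 1\<close>, which
  gives each fork its direction. The condition on \<open>hd (p @ [s])\<close> also covers an empty
  prefix.\<close>

lemma escape_chain:
  assumes "finite U" "card U = d" "\<And>x. x \<in> U \<Longrightarrow> s + d < x \<and> x < n - 1"
    and "1 \<le> s" "s + d < n - 1" "distinct p" "set p \<subseteq> {1..n}" "hd (p @ [s]) = 1"
    and "set p \<inter> ({s..s + d} \<union> U \<union> {n - 1, n}) = {}"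
  shows "\<exists>L\<ge>fact d. (path_step n ^^ L) (p @ [s, n]) (p @ [s, n - 1, n])"
  using assms
proof (induction d arbitrary: U s p)
  case 0
  \<comment> \<open>With no free node left, one step inserting \<open>n - 1\<close> suffices,
    matching \<open>fact 0 = 1\<close>.\<close>
  have "path_step n (p @ s # [] @ n # []) (p @ s # [n - 1] @ n # [])"
    using 0 by (intro fork_path_step)
      (auto simp: source_target_path_def hd_append split: if_splits
        intro: arc_rank_less arc_rank_same_source)
  then show ?case by (intro exI[of _ 1]) (auto simp: relpowp_1[unfolded One_nat_def])
next
  case (Suc d)
  note U = Suc.prems(3) and s = Suc.prems(4,5) and p = Suc.prems(6-9)
  have st: "source_target_path n (p @ s # zs @ [n])"
    if "distinct zs" "set zs \<subseteq> U \<union> {s + 1, n - 1}" for zs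
    using that U[of s] U[of n] U s p
    by (auto simp: source_target_path_def hd_append split: if_splits) fastforce+
  have escape: "path_step n (p @ [s, n]) (p @ [s, n - 1, n])"
    "x \<in> U \<Longrightarrow> path_step n (p @ [s, x, n - 1, n]) (p @ [s, n - 1, n])" for x
    using fork_path_step[of n p s "[]" n "[]" "[n - 1]"]
      fork_path_step[of n p s "[x]" "n - 1" "[n]" "[]"]
      st[of "[]"] st[of "[n - 1]"] st[of "[x, n - 1]"] U[of x] s
    by (auto simp: arc_rank_less arc_rank_same_source)
  have descend: "path_step n (p @ [s, n]) (p @ [s, y, s + 1, n])" if "y \<in> U" for y
    using fork_path_step[of n p s "[]" n "[]" "[y, s + 1]"]
      st[of "[]"] st[of "[y, s + 1]"] U[of y] s that
    by (auto simp: arc_rank_less arc_rank_same_source)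
  have switch: "path_step n (p @ [s, x, n - 1, n]) (p @ [s, y, s + 1, n])"
    if "x \<in> U" "y \<in> U" "x < y" for x y
    using fork_path_step[of n p s "[x, n - 1]" n "[]" "[y, s + 1]"]
      st[of "[x, n - 1]"] st[of "[y, s + 1]"] U[of x] U[of y] s that
    by (auto simp: arc_rank_less arc_rank_same_source)
  have ascend: "path_step n (p @ [s, y, s + 1, n - 1, n]) (p @ [s, y, n - 1, n])" if "y \<in> U" for y
    using fork_path_step[of n "p @ [s]" y "[s + 1]" "n - 1" "[n]" "[]"]
      st[of "[y, s + 1, n - 1]"] st[of "[y, n - 1]"] U[of y] s that
    by (auto simp: arc_rank_less arc_rank_same_source)
  \<comment> \<open>Invariant after the nodes of \<open>A\<close> are processed: the chain is still
    at its start or has just left the subchain of some \<open>x\<close> in \<open>A\<close>, and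
    each processed node contributed at least \<open>fact d\<close> steps.\<close>
  have "\<exists>L P. L \<ge> card A * fact d \<and> (path_step n ^^ L) (p @ [s, n]) P \<and>
      (P = p @ [s, n] \<or> (\<exists>x\<in>A. P = p @ [s, x, n - 1, n]))" if "A \<subseteq> U" for A
  proof -
    have "finite A" using that Suc.prems(1) finite_subset by blast
    then show ?thesis using that
    \<comment> \<open>Nodes are added in increasing order because \<open>switch\<close> improves
      only from \<open>x\<close> to a larger \<open>y\<close>.\<close>
    proof (induction A rule: finite_linorder_max_induct)
      case empty
      then show ?case by (intro exI[of _ 0]) auto
    next
      case (insert y A)
      then obtain L P where L: "L \<ge> card A * fact d" "(path_step n ^^ L) (p @ [s, n]) P"
        and P: "P = p @ [s, n] \<or> (\<exists>x\<in>A. P = p @ [s, x, n - 1, n])" by auto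
      have y: "y \<in> U" using insert by auto
      have to_y: "path_step n P (p @ [s, y, s + 1, n])"
        using P descend switch insert y by auto
      \<comment> \<open>The recursive call moves \<open>s\<close> and \<open>y\<close> into the
        prefix and continues from \<open>s + 1\<close>.\<close>
      have "\<exists>M\<ge>fact d. (path_step n ^^ M) ((p @ [s, y]) @ [s + 1, n]) ((p @ [s, y]) @ [s + 1, n - 1, n])"
      proof (rule Suc.IH)
        show "finite (U - {y})" "card (U - {y}) = d" using Suc.prems(1,2) y by auto
        show "hd ((p @ [s, y]) @ [s + 1]) = 1" using p(3) by (cases p) auto
      qed (use U[OF y] U s p y in \<open>auto, (force dest: U)+\<close>)
      then obtain M where M: "M \<ge> fact d"
        "(path_step n ^^ M) (p @ [s, y, s + 1, n]) (p @ [s, y, s + 1, n - 1, n])" by auto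
      have "(path_step n ^^ (Suc L + M)) (p @ [s, n]) (p @ [s, y, s + 1, n - 1, n])"
        by (rule relpowp_trans[OF relpowp_Suc_I[OF L(2) to_y] M(2)])
      then have "(path_step n ^^ Suc (Suc L + M)) (p @ [s, n]) (p @ [s, y, n - 1, n])"
        by (rule relpowp_Suc_I) (rule ascend[OF y])
      moreover have "card (insert y A) = Suc (card A)"
        using insert.hyps by (subst card_insert_disjoint) auto
      ultimately show ?case using L(1) M(1) by (intro exI[of _ "Suc (Suc L + M)"]) auto
    qed
  qed
  from this[of U] obtain L P where L: "L \<ge> card U * fact d" "(path_step n ^^ L) (p @ [s, n]) P"
    and P: "P = p @ [s, n] \<or> (\<exists>x\<in>U. P = p @ [s, x, n - 1, n])" by auto
  have "(path_step n ^^ Suc L) (p @ [s, n]) (p @ [s, n - 1, n])"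
    using P escape by (intro relpowp_Suc_I[OF L(2)]) auto
  \<comment> \<open>\<open>card U * fact d\<close> is \<open>Suc d * fact d\<close>.\<close>
  moreover have "fact (Suc d) \<le> Suc L" using L(1) Suc.prems(2) by simp
  ultimately show ?case by blast
qed

section \<open>The optimum and the resulting monotone path\<close>

text \<open>Another path either leaves \<open>1\<close> by an arc outranking
  \<open>(1, n - 1)\<close>, or goes on from \<open>n - 1\<close> to some \<open>z < n - 1\<close>,
  whose outgoing arc outranks \<open>(n - 1, n)\<close>.\<close>

lemma optimal_path:
  assumes n: "3 \<le> n"
  shows "optimal_vertex (shortest_path_polytope n) (rank_cost n) (path_vector [1, n - 1, n])"
proof -
  let ?o = "[1, n - 1, n]"
  have o: "source_target_path n ?o" using n by (auto simp: source_target_path_def)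
  have "rank_cost n (path_vector ?o) < rank_cost n (path_vector p)"
    if p: "source_target_path n p" "p \<noteq> ?o" for p
  proof -
    obtain y p' where p': "p = 1 # y # p'"
      using p n by (cases p; cases "tl p") (auto simp: source_target_path_def)
    show ?thesis
    proof (cases "y = n - 1")
      case False
      have "1 \<le> y" "y \<le> n" using p(1) p' by (auto simp: source_target_path_def)
      then show ?thesis
        using False n p' by (intro rank_cost_less[OF p(1) o, of "(1, y)"])
          (auto intro: arc_rank_less arc_rank_same_source)
    next
      case True
      obtain z p'' where p'': "p' = z # p''"
        using p True n p' by (cases p') (auto simp: source_target_path_def)
      have "p'' \<noteq> []" using p p' p'' True by (auto simp: source_target_path_def)
      then have "z \<noteq> 1" "z \<noteq> n - 1" "z \<noteq> n" "z \<le> n"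
        using p(1) p' p'' True by (auto simp: source_target_path_def)
      then have z: "z \<noteq> 1" "z \<noteq> n" "z < n - 1" by auto
      then have "(z, hd p'') \<in> path_arcs p - path_arcs ?o"
        using p' p'' \<open>p'' \<noteq> []\<close> by (auto simp: path_arcs_Cons)
      then show ?thesis
        using z n p' True by (intro rank_cost_less[OF p(1) o]) (auto intro: arc_rank_less)
    qed
  qed
  then have "rank_cost n (path_vector ?o) \<le> rank_cost n x"
    if "x \<in> path_vector ` Collect (source_target_path n)" for x
    using that by (force intro: less_imp_le)
  then have "rank_cost n (path_vector ?o) \<le> rank_cost n x" if "x \<in> shortest_path_polytope n" for x
    using that linear_ge_on_convex_hull nondegenerate_rank_cost[of n]
    unfolding shortest_path_polytope_eq nondegenerate_objective_def by blast
  then show ?thesis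
    using path_vector_extreme_point[OF o] by (simp add: optimal_vertex_def)
qed

lemma monotone_path_of_chain:
  assumes "3 \<le> n" "(path_step n ^^ L) p [1, n - 1, n]" "source_target_path n p"
  obtains vs where "monotone_path (shortest_path_polytope n) vs" "path_length vs = L"
proof -
  obtain f where f: "f 0 = p" "f L = [1, n - 1, n]" "\<And>i. i < L \<Longrightarrow> path_step n (f i) (f (Suc i))"
    using assms(2) by (auto simp: relpowp_fun_conv)
  have st: "source_target_path n (f i)" if "i \<le> L" for i
    using that f assms(3) by (cases i) (auto simp: path_step_def Suc_le_eq)
  let ?vs = "map (\<lambda>i. path_vector (f i)) [0..<Suc L]"
  have "successively (oriented_edge (shortest_path_polytope n) (rank_cost n)) ?vs"
    using f(3) by (auto simp: successively_conv_nth path_step_def simp del: upt_Suc)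
  moreover have "set ?vs \<subseteq> {v. v extreme_point_of shortest_path_polytope n}"
    using st path_vector_extreme_point by (auto simp: less_Suc_eq_le)
  moreover have "last ?vs = path_vector [1, n - 1, n]" using f(2) by simp
  ultimately have "monotone_path_for (shortest_path_polytope n) (rank_cost n) ?vs"
    using optimal_path[OF assms(1)] by (simp add: monotone_path_for_def)
  then have "monotone_path (shortest_path_polytope n) ?vs"
    using nondegenerate_rank_cost by (auto simp: monotone_path_def)
  moreover have "path_length ?vs = L" by (simp add: path_length_def)
  ultimately show ?thesis using that by blast
qed

lemma long_monotone_path:
  assumes n: "3 \<le> n"
  obtains vs where "monotone_path (shortest_path_polytope n) vs"
    "fact ((n - 3) div 2) \<le> path_length vs"
proof -
  define k where "k = (n - 3) div 2"
  have "2 * k + 3 \<le> n" using n by (simp add: k_def)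
  then have "\<exists>L\<ge>fact k. (path_step n ^^ L) ([] @ [1, n]) ([] @ [1, n - 1, n])"
    \<comment> \<open>Level nodes are \<open>1, ..., k + 1\<close>, free nodes
      \<open>k + 2, ..., 2 * k + 1\<close>; with \<open>n - 1\<close> and \<open>n\<close> this
      takes \<open>2 * k + 3\<close> nodes.\<close>
    by (intro escape_chain[of "{k + 2..<2 * k + 2}"]) auto
  then obtain L where L: "L \<ge> fact k" "(path_step n ^^ L) [1, n] [1, n - 1, n]" by auto
  have "source_target_path n [1, n]" using n by (simp add: source_target_path_def)
  then show ?thesis using that L monotone_path_of_chain[OF n] unfolding k_def by metis
qed

section \<open>Factorial estimates and the final bound\<close>

text \<open>Passing from \<open>k\<close> to \<open>Suc k\<close> multiplies the left side by
  \<open>(2 * k + 2) * (2 * k + 1)\<close> and the right by \<open>Suc k ^ 3\<close>, which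
  dominates from \<open>k = 3\<close> on. The constant 4 covers the earlier cases, where the ratio
  peaks at 10/3.\<close>

lemma fact_double_le: "fact (2 * k) \<le> 4 * (fact k :: nat) ^ 3"
proof (induction k)
  case (Suc k)
  show ?case
  proof (cases "k < 3")
    case True
    then have "k = 0 \<or> k = 1 \<or> k = 2" by auto
    then show ?thesis by (auto simp: fact_numeral eval_nat_numeral)
  next
    case False
    then obtain j where j: "k = j + 3" using le_Suc_ex[of 3 k] by (auto simp: add.commute)
    have "(2 * k + 2) * (2 * k + 1) \<le> Suc k ^ 3"
      unfolding j by (simp add: power3_eq_cube algebra_simps)
    then have "(2 * k + 2) * (2 * k + 1) * fact (2 * k) \<le> Suc k ^ 3 * (4 * fact k ^ 3 :: nat)"
      using Suc.IH by (rule mult_le_mono)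
    moreover have "fact (2 * Suc k) = (2 * k + 2) * (2 * k + 1) * (fact (2 * k) :: nat)"
      by (simp add: algebra_simps)
    moreover have "4 * (fact (Suc k) :: nat) ^ 3 = Suc k ^ 3 * (4 * fact k ^ 3)"
      by (simp only: fact_Suc of_nat_id power_mult_distrib mult_ac)
    ultimately show ?thesis by (simp only:)
  qed
qed simp

lemma fact_le_fact_half_cubed:
  assumes "3 \<le> n"
  shows "fact n \<le> 64 * n ^ 6 * (fact ((n - 3) div 2) :: nat) ^ 3"
proof -
  define k where "k = (n - 3) div 2"
  have n: "n \<le> 2 * k + 4" "2 * k + 4 \<le> 2 * n" using assms by (auto simp: k_def)
  have "(fact n :: nat) \<le> fact (2 * k + 4)" using n(1) by (rule fact_mono)
  also have "\<dots> = (2 * k + 4) * (2 * k + 3) * (2 * k + 2) * (2 * k + 1) * fact (2 * k)"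
    by (simp add: eval_nat_numeral algebra_simps)
  also have "\<dots> \<le> (2 * n) * (2 * n) * (2 * n) * (2 * n) * (4 * fact k ^ 3)"
    using n by (intro mult_le_mono fact_double_le) auto
  also have "\<dots> = 64 * n ^ 4 * fact k ^ 3" by (simp add: power4_eq_xxxx)
  \<comment> \<open>Rounding \<open>n ^ 4\<close> up to \<open>n ^ 6\<close> makes the bound the
    perfect cube of \<open>4 * n ^ 2 * fact k\<close>.\<close>
  also have "\<dots> \<le> 64 * n ^ 6 * fact k ^ 3"
    using assms by (intro mult_le_mono power_increasing) auto
  finally show ?thesis by (simp add: k_def)
qed

theorem theorem1p8:
  shows "\<exists>C::real. C > 0 \<and>
    (\<forall>n::nat. n \<ge> 3 \<longrightarrow>
      (\<exists>vs. monotone_path (shortest_path_polytope n) vs \<and>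
        real (path_length vs) > C / real n ^ 2 * root 3 (fact n)))"
proof (intro exI[of _ "1 / 5"] conjI allI impI)
  fix n :: nat
  assume n: "3 \<le> n"
  define k where "k = (n - 3) div 2"
  obtain vs where vs: "monotone_path (shortest_path_polytope n) vs" "fact k \<le> path_length vs"
    using long_monotone_path[OF n] unfolding k_def by blast
  have "(fact n :: real) \<le> (4 * real n ^ 2 * fact k) ^ 3"
    using fact_le_fact_half_cubed[OF n, folded k_def]
    by (simp add: power_mult_distrib flip: of_nat_le_iff[where 'a = real] power_mult)
  then have "root 3 (fact n) \<le> 4 * real n ^ 2 * fact k"
    by (metis real_root_le_iff real_root_pos2 mult_nonneg_nonneg zero_le_power of_nat_0_le_iff
        fact_ge_zero zero_le_numeral zero_less_numeral)
  then have "1 / 5 / real n ^ 2 * root 3 (fact n) \<le> 1 / 5 / real n ^ 2 * (4 * real n ^ 2 * fact k)"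
    by (intro mult_left_mono) auto
  \<comment> \<open>The constant 1/5 lies below 1/4, the reciprocal of the factor 4 from the cube
    root, which makes the final inequality strict.\<close>
  also have "\<dots> = 4 / 5 * fact k" using n by simp
  also have "\<dots> < fact k" by simp
  also have "\<dots> \<le> real (path_length vs)"
    using vs(2) by (metis of_nat_fact of_nat_le_iff)
  finally show "\<exists>vs. monotone_path (shortest_path_polytope n) vs \<and>
      real (path_length vs) > 1 / 5 / real n ^ 2 * root 3 (fact n)"
    using vs(1) by blast
qed simp

end
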